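(* Let $K_t:SE(3)\to\mathbb{R}_{\ge0}$ be a square-integrable probability density with respect to $dg$, so that $(g,g_0)\mapsto K_t(g_0^{-1}g)$ is a left-invariant kernel, and let $P(\cdot\mid O_1,O_2)$ be a diffusion frame selection mechanism, i.e. a probability distribution on $SE(3)$ conditioned on a pair of point clouds $O_1,O_2\in\mathcal{O}$. Define the diffusion kernel $$P_{t|0}(g\mid g_0,O_s,O_e)=\int_{SE(3)}dg_{ed}\;P(g_{ed}\mid g_0^{-1}\cdot O_s,\,O_e)\;K_t\!\left(g_{ed}^{-1}\,g_0^{-1}\,g\,g_{ed}\right).$$ If the frame selection mechanism satisfies $$P(g_{ed}\mid g_0^{-1}\cdot O_s,\,O_e)=P(\Delta g\,g_{ed}\mid(\Delta g\,g_0^{-1})\cdot O_s,\,\Delta g\cdot O_e)$$ for all $\Delta g,g_{ed},g_0\in SE(3)$ and $O_s,O_e\in\mathcal{O}$, then the diffusion kernel $P_{t|0}$ is bi-equivariant.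
   Context: $\mathcal{O}$ is the set of point clouds in $\mathbb{R}^3$, on which $SE(3)$ acts from the left by rigid motion of the points, written $\Delta g\cdot O$. $dg$ is the bi-invariant (Haar) measure on $SE(3)$; probability distributions are written through their densities with respect to $dg$ (for a frame selection mechanism without density, the integral is against the corresponding probability measure and the equivariance identity is the corresponding identity of measures). A kernel $P_{t|0}(g\mid g_0)$ is left invariant if $P_{t|0}(\Delta g\,g\mid\Delta g\,g_0)=P_{t|0}(g\mid g_0)$ for all $\Delta g$; such kernels are exactly those of the form $K_t(g_0^{-1}g)$. A bi-equivariant diffusion kernel is a square-integrable (in $g$) kernel $P_{t|0}$ satisfying, for all $\Delta g\in SE(3)$ (and all $O_s,O_e\in\mathcal{O}$), except on a set of measure zero, $$P_{t|0}(g\mid g_0,O_s,O_e)=P_{t|0}(\Delta g\,g\mid\Delta g\,g_0,\Delta g\cdot O_s,O_e)=P_{t|0}(g\,\Delta g^{-1}\mid g_0\,\Delta g^{-1},O_s,\Delta g\cdot O_e).$$ *)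

theory Defs
  imports "HOL-Probability.Probability" "HOL-Algebra.Group"
begin

text \<open>The pair \<open>(R, v)\<close> stands for the rigid motion \<open>x \<mapsto> R x + v\<close>.\<close>

type_synonym rigid = "(real^3^3) \<times> (real^3)"

definition rigid_apply :: "rigid \<Rightarrow> real^3 \<Rightarrow> real^3" where
  "rigid_apply g x = fst g *v x + snd g"

definition SE3 :: "rigid monoid" where
  "SE3 = \<lparr>carrier = {g. rotation_matrix (fst g)},
          mult = (\<lambda>g h. (fst g ** fst h, fst g *v snd h + snd g)),
          one = (mat 1, 0)\<rparr>"

text \<open>
  A point cloud is a nonempty finite set of points. Nonemptiness matters: for a pair of empty
  clouds the equivariance assumed below would require a left-invariant probability measure on
  the non-compact group \<open>SE3\<close>, which does not exist.
\<close>

definition point_clouds :: "(real^3) set set" where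
  "point_clouds = {C. finite C \<and> C \<noteq> {}}"

definition cloud_act :: "rigid \<Rightarrow> (real^3) set \<Rightarrow> (real^3) set"  (infixr "\<bullet>\<^sub>c" 75) where
  "g \<bullet>\<^sub>c C = rigid_apply g ` C"

lemma rotation_matrix_mult:
  fixes A B :: "real^'n^'n"
  assumes "rotation_matrix A" "rotation_matrix B"
  shows "rotation_matrix (A ** B)"
  using assms by (auto simp: rotation_matrix_def orthogonal_matrix_mul det_mul)

lemma rotation_matrix_transpose:
  fixes A :: "real^'n^'n"
  assumes "rotation_matrix A"
  shows "rotation_matrix (transpose A)"
  using assms by (auto simp: rotation_matrix_def orthogonal_matrix_transpose)

lemma group_SE3: "group SE3"
proof (rule groupI)
  fix g assume g: "g \<in> carrier SE3"
  define R v where "R = fst g" and "v = snd g"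
  have gp: "g = (R, v)" by (simp add: R_def v_def)
  have R: "rotation_matrix R" using g by (simp add: SE3_def R_def)
  then have "transpose R ** R = mat 1"
    by (simp add: rotation_matrix_def orthogonal_matrix)
  with rotation_matrix_transpose[OF R]
  show "\<exists>h\<in>carrier SE3. h \<otimes>\<^bsub>SE3\<^esub> g = \<one>\<^bsub>SE3\<^esub>"
    by (intro bexI[of _ "(transpose R, - (transpose R *v v))"]) (auto simp: SE3_def gp)
qed (auto simp: SE3_def rotation_matrix_mult matrix_mul_assoc matrix_vector_right_distrib
    matrix_vector_mul_assoc add.assoc rotation_matrix_def[of "mat 1"] orthogonal_matrix_id)

lemma cloud_act_closed: "C \<in> point_clouds \<Longrightarrow> g \<bullet>\<^sub>c C \<in> point_clouds"
  by (simp add: point_clouds_def cloud_act_def)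

lemma cloud_act_one: "\<one>\<^bsub>SE3\<^esub> \<bullet>\<^sub>c C = C"
  by (simp add: cloud_act_def rigid_apply_def SE3_def)

lemma cloud_act_mult: "(g \<otimes>\<^bsub>SE3\<^esub> h) \<bullet>\<^sub>c C = g \<bullet>\<^sub>c h \<bullet>\<^sub>c C"
  by (simp add: cloud_act_def rigid_apply_def SE3_def image_image matrix_vector_right_distrib
      matrix_vector_mul_assoc add.assoc)

definition SE3_borel :: "rigid measure" where
  "SE3_borel = restrict_space borel (carrier SE3)"

text \<open>
  A nonzero bi-invariant Borel measure that is finite on compact sets. Such a measure on
  \<open>SE3\<close> exists and is unique up to a positive factor, so quantifying over all of them
  covers every normalisation of the Haar measure.
\<close>

definition haar_SE3 :: "rigid measure \<Rightarrow> bool" where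
  "haar_SE3 \<mu> \<longleftrightarrow>
     sets \<mu> = sets SE3_borel \<and>
     emeasure \<mu> (space \<mu>) \<noteq> 0 \<and>
     (\<forall>C. compact C \<and> C \<subseteq> carrier SE3 \<longrightarrow> emeasure \<mu> C < \<infinity>) \<and>
     (\<forall>g\<in>carrier SE3. \<forall>A\<in>sets \<mu>.
        emeasure \<mu> ((\<lambda>x. g \<otimes>\<^bsub>SE3\<^esub> x) ` A) = emeasure \<mu> A \<and>
        emeasure \<mu> ((\<lambda>x. x \<otimes>\<^bsub>SE3\<^esub> g) ` A) = emeasure \<mu> A)"

definition probability_density :: "'a measure \<Rightarrow> ('a \<Rightarrow> ennreal) \<Rightarrow> bool" where
  "probability_density M f \<longleftrightarrow> f \<in> borel_measurable M \<and> (\<integral>\<^sup>+x. f x \<partial>M) = 1"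

definition square_integrable :: "'a measure \<Rightarrow> ('a \<Rightarrow> ennreal) \<Rightarrow> bool" where
  "square_integrable M f \<longleftrightarrow> f \<in> borel_measurable M \<and> (\<integral>\<^sup>+x. (f x)\<^sup>2 \<partial>M) < \<infinity>"

text \<open>
  A mechanism is either a family of densities \<open>p h O1 O2\<close> with respect to \<open>\<mu>\<close>, with \<open>h\<close> the
  selected frame, or more generally a family of probability measures \<open>P O1 O2\<close>.
\<close>

definition frame_selection_density ::
  "rigid measure \<Rightarrow> (rigid \<Rightarrow> (real^3) set \<Rightarrow> (real^3) set \<Rightarrow> real) \<Rightarrow> bool" where
  "frame_selection_density \<mu> p \<longleftrightarrow>
     (\<forall>O1\<in>point_clouds. \<forall>O2\<in>point_clouds.
        (\<forall>h\<in>carrier SE3. 0 \<le> p h O1 O2) \<and>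
        probability_density \<mu> (\<lambda>h. ennreal (p h O1 O2)))"

definition frame_selection ::
  "((real^3) set \<Rightarrow> (real^3) set \<Rightarrow> rigid measure) \<Rightarrow> bool" where
  "frame_selection P \<longleftrightarrow>
     (\<forall>O1\<in>point_clouds. \<forall>O2\<in>point_clouds.
        prob_space (P O1 O2) \<and> sets (P O1 O2) = sets SE3_borel)"

definition equivariant_frame_selection_density ::
  "(rigid \<Rightarrow> (real^3) set \<Rightarrow> (real^3) set \<Rightarrow> real) \<Rightarrow> bool" where
  "equivariant_frame_selection_density p \<longleftrightarrow>
     (\<forall>d\<in>carrier SE3. \<forall>h\<in>carrier SE3. \<forall>g0\<in>carrier SE3.
      \<forall>Os\<in>point_clouds. \<forall>Oe\<in>point_clouds.
        p h (inv\<^bsub>SE3\<^esub> g0 \<bullet>\<^sub>c Os) Oe =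
        p (d \<otimes>\<^bsub>SE3\<^esub> h) ((d \<otimes>\<^bsub>SE3\<^esub> inv\<^bsub>SE3\<^esub> g0) \<bullet>\<^sub>c Os) (d \<bullet>\<^sub>c Oe))"

text \<open>
  Substituting \<open>h \<mapsto> d h\<close>, the density identity says that \<open>P\<close> at the moved clouds is the
  image of \<open>P\<close> at the original clouds under left multiplication by \<open>d\<close>.
\<close>

definition equivariant_frame_selection ::
  "((real^3) set \<Rightarrow> (real^3) set \<Rightarrow> rigid measure) \<Rightarrow> bool" where
  "equivariant_frame_selection P \<longleftrightarrow>
     (\<forall>d\<in>carrier SE3. \<forall>g0\<in>carrier SE3. \<forall>Os\<in>point_clouds. \<forall>Oe\<in>point_clouds.
        distr (P (inv\<^bsub>SE3\<^esub> g0 \<bullet>\<^sub>c Os) Oe) SE3_borel (\<lambda>h. d \<otimes>\<^bsub>SE3\<^esub> h) =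
        P ((d \<otimes>\<^bsub>SE3\<^esub> inv\<^bsub>SE3\<^esub> g0) \<bullet>\<^sub>c Os) (d \<bullet>\<^sub>c Oe))"

text \<open>
  A kernel value \<open>P g g0 Os Oe\<close> is the density at \<open>g\<close> given \<open>g0\<close>, \<open>Os\<close>, \<open>Oe\<close>. Values are
  extended nonnegative reals because the integrals below may diverge for exceptional \<open>g\<close>;
  square-integrability makes the kernel finite for almost every \<open>g\<close>.
\<close>

type_synonym diffusion_kernel =
  "rigid \<Rightarrow> rigid \<Rightarrow> (real^3) set \<Rightarrow> (real^3) set \<Rightarrow> ennreal"

definition bi_equivariant_diffusion_kernel :: "rigid measure \<Rightarrow> diffusion_kernel \<Rightarrow> bool" where
  "bi_equivariant_diffusion_kernel \<mu> P \<longleftrightarrow>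
     (\<forall>g0\<in>carrier SE3. \<forall>Os\<in>point_clouds. \<forall>Oe\<in>point_clouds.
        probability_density \<mu> (\<lambda>g. P g g0 Os Oe) \<and>
        square_integrable \<mu> (\<lambda>g. P g g0 Os Oe) \<and>
        (\<forall>d\<in>carrier SE3. AE g in \<mu>.
           P g g0 Os Oe = P (d \<otimes>\<^bsub>SE3\<^esub> g) (d \<otimes>\<^bsub>SE3\<^esub> g0) (d \<bullet>\<^sub>c Os) Oe \<and>
           P g g0 Os Oe =
             P (g \<otimes>\<^bsub>SE3\<^esub> inv\<^bsub>SE3\<^esub> d) (g0 \<otimes>\<^bsub>SE3\<^esub> inv\<^bsub>SE3\<^esub> d) Os (d \<bullet>\<^sub>c Oe)))"

definition frame_kernel_density ::
  "rigid measure \<Rightarrow> (rigid \<Rightarrow> real) \<Rightarrow>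
   (rigid \<Rightarrow> (real^3) set \<Rightarrow> (real^3) set \<Rightarrow> real) \<Rightarrow> diffusion_kernel" where
  "frame_kernel_density \<mu> K p g g0 Os Oe =
     (\<integral>\<^sup>+h. ennreal (p h (inv\<^bsub>SE3\<^esub> g0 \<bullet>\<^sub>c Os) Oe) *
           ennreal (K (inv\<^bsub>SE3\<^esub> h \<otimes>\<^bsub>SE3\<^esub> inv\<^bsub>SE3\<^esub> g0 \<otimes>\<^bsub>SE3\<^esub> g \<otimes>\<^bsub>SE3\<^esub> h)) \<partial>\<mu>)"

definition frame_kernel ::
  "(rigid \<Rightarrow> real) \<Rightarrow> ((real^3) set \<Rightarrow> (real^3) set \<Rightarrow> rigid measure) \<Rightarrow> diffusion_kernel" where
  "frame_kernel K P g g0 Os Oe =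
     (\<integral>\<^sup>+h. ennreal (K (inv\<^bsub>SE3\<^esub> h \<otimes>\<^bsub>SE3\<^esub> inv\<^bsub>SE3\<^esub> g0 \<otimes>\<^bsub>SE3\<^esub> g \<otimes>\<^bsub>SE3\<^esub> h))
        \<partial>(P (inv\<^bsub>SE3\<^esub> g0 \<bullet>\<^sub>c Os) Oe))"

end

theory Submission
  imports Defs
begin

text \<open>
  Both equivariances hold pointwise: the left one because the kernel depends on \<open>g\<close>, \<open>g0\<close>, \<open>Os\<close>
  only through the invariants \<open>inv g0 g\<close> and \<open>inv g0 \<bullet> Os\<close>, the right one by substituting
  \<open>h \<mapsto> d h\<close>. For fixed \<open>h\<close> the map \<open>g \<mapsto> inv h inv g0 g h\<close> preserves the Haar measure, so by
  Tonelli the kernel is an average of copies of \<open>K\<close> of the same mass and the same square integral,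
  and Cauchy--Schwarz bounds the square of the average by the average of the squares. A mechanism
  with a density is reduced to the mechanism of measures that it defines.
\<close>

section \<open>Preliminaries: continuity of matrix operations and a Cauchy--Schwarz bound\<close>

lemma continuous_on_matrix_matrix_mult [continuous_intros]:
  fixes A :: "'a::topological_space \<Rightarrow> real^'n^'m" and B :: "'a \<Rightarrow> real^'k^'n"
  assumes "continuous_on S A" "continuous_on S B"
  shows "continuous_on S (\<lambda>x. A x ** B x)"
  unfolding matrix_matrix_mult_def by (intro continuous_intros assms)

lemma continuous_on_matrix_vector_mult [continuous_intros]:
  fixes A :: "'a::topological_space \<Rightarrow> real^'n^'m" and v :: "'a \<Rightarrow> real^'n"
  assumes "continuous_on S A" "continuous_on S v"
  shows "continuous_on S (\<lambda>x. A x *v v x)"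
  unfolding matrix_vector_mult_def by (intro continuous_intros assms)

lemma continuous_on_transpose [continuous_intros]:
  fixes A :: "'a::topological_space \<Rightarrow> real^'n^'m"
  assumes "continuous_on S A"
  shows "continuous_on S (\<lambda>x. transpose (A x))"
  unfolding transpose_def by (intro continuous_intros assms)

lemma continuous_on_det [continuous_intros]:
  fixes A :: "'a::topological_space \<Rightarrow> real^'n^'n"
  assumes "continuous_on S A"
  shows "continuous_on S (\<lambda>x. det (A x))"
  unfolding det_def by (intro continuous_intros assms)

text \<open>Cauchy--Schwarz with the constant \<open>1\<close> as second factor, whose square
  integrates to the total mass 1.\<close>

lemma (in prob_space) nn_integral_power2_le:
  assumes "f \<in> borel_measurable M"
  shows "(\<integral>\<^sup>+x. f x \<partial>M)\<^sup>2 \<le> (\<integral>\<^sup>+x. (f x)\<^sup>2 \<partial>M)"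
  using Cauchy_Schwarz_nn_integral[OF assms, of "\<lambda>_. 1"] by (simp add: emeasure_space_1)

section \<open>Translations, inverses and closedness in the rigid motion group\<close>

interpretation SE3: group SE3
  by (rule group_SE3)

text \<open>Bridges two forms of invariance: \<open>haar_SE3\<close> speaks of images of sets under
  translations, whereas \<open>distr\<close> measures preimages. Translation by \<open>g\<close> is
  a bijection of the carrier with inverse translation by \<open>inv g\<close>.\<close>

lemma (in group) vimage_mult_left:
  assumes "g \<in> carrier G" "A \<subseteq> carrier G"
  shows "(\<lambda>x. g \<otimes> x) -` A \<inter> carrier G = (\<lambda>x. inv g \<otimes> x) ` A"
proof (intro equalityI subsetI)
  fix x assume "x \<in> (\<lambda>x. g \<otimes> x) -` A \<inter> carrier G"
  then have "g \<otimes> x \<in> A" "x = inv g \<otimes> (g \<otimes> x)"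
    using assms by (simp_all add: m_assoc[symmetric])
  then show "x \<in> (\<lambda>x. inv g \<otimes> x) ` A" by blast
qed (use assms in \<open>auto simp: m_assoc[symmetric] subset_iff\<close>)

lemma (in group) vimage_mult_right:
  assumes "g \<in> carrier G" "A \<subseteq> carrier G"
  shows "(\<lambda>x. x \<otimes> g) -` A \<inter> carrier G = (\<lambda>x. x \<otimes> inv g) ` A"
proof (intro equalityI subsetI)
  fix x assume "x \<in> (\<lambda>x. x \<otimes> g) -` A \<inter> carrier G"
  then have "x \<otimes> g \<in> A" "x = (x \<otimes> g) \<otimes> inv g"
    using assms by (simp_all add: m_assoc)
  then show "x \<in> (\<lambda>x. x \<otimes> inv g) ` A" by blast
qed (use assms in \<open>auto simp: m_assoc subset_iff\<close>)

text \<open>The group inverse is defined abstractly; this formula displays it as a polynomial, hence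
  continuous, map of the entries. It rests on the transpose inverting a rotation matrix.\<close>

lemma inv_SE3:
  assumes "g \<in> carrier SE3"
  shows "inv\<^bsub>SE3\<^esub> g = (transpose (fst g), - (transpose (fst g) *v snd g))"
proof (rule SE3.inv_equality)
  have "rotation_matrix (fst g)" using assms by (simp add: SE3_def)
  then show "(transpose (fst g), - (transpose (fst g) *v snd g)) \<otimes>\<^bsub>SE3\<^esub> g = \<one>\<^bsub>SE3\<^esub>"
    and "(transpose (fst g), - (transpose (fst g) *v snd g)) \<in> carrier SE3"
    by (simp_all add: SE3_def rotation_matrix_transpose)
      (simp add: rotation_matrix_def orthogonal_matrix)
qed (fact assms)

text \<open>The carrier is cut out by equations between continuous functions. Closedness makes it
  Borel and makes its intersections with closed balls compact.\<close>

lemma closed_carrier_SE3: "closed (carrier SE3)"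
proof -
  have "carrier SE3 =
      {g. transpose (fst g) ** fst g = mat 1} \<inter> {g. det (fst g) = 1}"
    by (auto simp: SE3_def rotation_matrix_def orthogonal_matrix)
  then show ?thesis
    by (simp only:) (intro closed_Int closed_Collect_eq continuous_intros)
qed

section \<open>Borel measurability of the group operations\<close>

lemma space_SE3_borel [simp]: "space SE3_borel = carrier SE3"
  by (simp add: SE3_borel_def space_restrict_space)

lemma measurable_SE3_borel_iff:
  "f \<in> M \<rightarrow>\<^sub>M SE3_borel \<longleftrightarrow> f \<in> space M \<rightarrow> carrier SE3 \<and> f \<in> borel_measurable M"
  unfolding SE3_borel_def by (auto simp: measurable_restrict_space2_iff)

text \<open>The formula for the product is continuous on all pairs in the ambient vector space, so
  it preserves Borel measurability; closure of the group under products then restricts the target to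
  the carrier.\<close>

lemma SE3_mult_measurable [measurable (raw)]:
  assumes "f \<in> M \<rightarrow>\<^sub>M SE3_borel" "g \<in> M \<rightarrow>\<^sub>M SE3_borel"
  shows "(\<lambda>x. f x \<otimes>\<^bsub>SE3\<^esub> g x) \<in> M \<rightarrow>\<^sub>M SE3_borel"
  unfolding measurable_SE3_borel_iff
proof
  show "(\<lambda>x. f x \<otimes>\<^bsub>SE3\<^esub> g x) \<in> space M \<rightarrow> carrier SE3"
    using assms unfolding measurable_SE3_borel_iff by auto
  show "(\<lambda>x. f x \<otimes>\<^bsub>SE3\<^esub> g x) \<in> borel_measurable M"
  proof (rule borel_measurable_continuous_Pair[where H = "\<lambda>a b. a \<otimes>\<^bsub>SE3\<^esub> b"])
    show "continuous_on UNIV (\<lambda>x::rigid \<times> rigid. fst x \<otimes>\<^bsub>SE3\<^esub> snd x)"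
      unfolding SE3_def monoid.simps by (intro continuous_intros)
  qed (use assms in \<open>simp_all add: measurable_SE3_borel_iff\<close>)
qed

lemma SE3_inv_measurable [measurable (raw)]:
  assumes "f \<in> M \<rightarrow>\<^sub>M SE3_borel"
  shows "(\<lambda>x. inv\<^bsub>SE3\<^esub> f x) \<in> M \<rightarrow>\<^sub>M SE3_borel"
  unfolding measurable_SE3_borel_iff
proof
  have f: "f x \<in> carrier SE3" if "x \<in> space M" for x
    using assms that unfolding measurable_SE3_borel_iff by auto
  then show "(\<lambda>x. inv\<^bsub>SE3\<^esub> f x) \<in> space M \<rightarrow> carrier SE3"
    by auto
  \<comment> \<open>The explicit formula is continuous everywhere but agrees with the inverse only
    on the carrier. Measurability is therefore shown for the formula first and transferred
    afterwards, as \<open>f\<close> takes its values in the carrier.\<close>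
  have "(\<lambda>x. (transpose (fst (f x)), - (transpose (fst (f x)) *v snd (f x)))) \<in> borel_measurable M"
  proof (rule borel_measurable_continuous_on
      [where f = "\<lambda>g. (transpose (fst g), - (transpose (fst g) *v snd g))"])
    show "continuous_on UNIV (\<lambda>g::rigid. (transpose (fst g), - (transpose (fst g) *v snd g)))"
      by (intro continuous_intros)
  qed (use assms in \<open>simp add: measurable_SE3_borel_iff\<close>)
  then show "(\<lambda>x. inv\<^bsub>SE3\<^esub> f x) \<in> borel_measurable M"
    by (subst measurable_cong[OF inv_SE3[OF f]])
qed

section \<open>Haar measure: sigma-finiteness and invariance of integrals\<close>

context
  fixes \<mu> :: "rigid measure"
  assumes haar: "haar_SE3 \<mu>"
begin

lemma sets_haar [measurable_cong]: "sets \<mu> = sets SE3_borel"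
  using haar by (simp add: haar_SE3_def)

lemma space_haar: "space \<mu> = carrier SE3"
  using sets_eq_imp_space_eq[OF sets_haar] by simp

text \<open>A closed subset of a Euclidean space is a countable union of compact pieces, its
  intersections with balls of integer radius, and \<mu> is finite on each of them. This is what
  permits Tonelli below.\<close>

lemma sigma_finite_haar: "sigma_finite_measure \<mu>"
proof
  let ?C = "\<lambda>n::nat. carrier SE3 \<inter> cball 0 (real n)"
  have "?C n \<in> sets \<mu>" for n
    unfolding sets_haar SE3_borel_def
    by (subst sets_restrict_space_iff) (auto intro: borel_closed closed_carrier_SE3)
  moreover have "(\<Union>n. ?C n) = space \<mu>"
    by (auto simp: space_haar real_arch_simple)
  moreover have "emeasure \<mu> (?C n) < \<infinity>" for n
    using haar closed_carrier_SE3 by (auto simp: haar_SE3_def closed_Int_compact)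
  ultimately show "\<exists>A. countable A \<and> A \<subseteq> sets \<mu> \<and> \<Union>A = space \<mu> \<and> (\<forall>a\<in>A. emeasure \<mu> a \<noteq> \<infinity>)"
    by (intro exI[of _ "range ?C"]) (auto simp: less_top)
qed

lemma distr_haar_mult_left:
  assumes g: "g \<in> carrier SE3"
  shows "distr \<mu> \<mu> (\<lambda>x. g \<otimes>\<^bsub>SE3\<^esub> x) = \<mu>"
proof (rule measure_eqI)
  fix A assume "A \<in> sets (distr \<mu> \<mu> (\<lambda>x. g \<otimes>\<^bsub>SE3\<^esub> x))"
  then have A: "A \<in> sets \<mu>" by simp
  then have sub: "A \<subseteq> carrier SE3" using sets.sets_into_space space_haar by blast
  \<comment> \<open>In this form the fact lets the measurability prover accept the constant factor
    \<open>g\<close> as a map into \<open>SE3_borel\<close>.\<close>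
  have g': "g \<in> space SE3_borel" using g by simp
  have [measurable]: "(\<lambda>x. g \<otimes>\<^bsub>SE3\<^esub> x) \<in> \<mu> \<rightarrow>\<^sub>M \<mu>"
    using g' by measurable
  have "(\<lambda>x. g \<otimes>\<^bsub>SE3\<^esub> x) -` A \<inter> space \<mu> = (\<lambda>x. inv\<^bsub>SE3\<^esub> g \<otimes>\<^bsub>SE3\<^esub> x) ` A"
    unfolding space_haar by (rule SE3.vimage_mult_left[OF g sub])
  then show "emeasure (distr \<mu> \<mu> (\<lambda>x. g \<otimes>\<^bsub>SE3\<^esub> x)) A = emeasure \<mu> A"
    using haar g A by (simp add: emeasure_distr haar_SE3_def)
qed simp

lemma distr_haar_mult_right:
  assumes g: "g \<in> carrier SE3"
  shows "distr \<mu> \<mu> (\<lambda>x. x \<otimes>\<^bsub>SE3\<^esub> g) = \<mu>"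
proof (rule measure_eqI)
  fix A assume "A \<in> sets (distr \<mu> \<mu> (\<lambda>x. x \<otimes>\<^bsub>SE3\<^esub> g))"
  then have A: "A \<in> sets \<mu>" by simp
  then have sub: "A \<subseteq> carrier SE3" using sets.sets_into_space space_haar by blast
  have g': "g \<in> space SE3_borel" using g by simp
  have [measurable]: "(\<lambda>x. x \<otimes>\<^bsub>SE3\<^esub> g) \<in> \<mu> \<rightarrow>\<^sub>M \<mu>"
    using g' by measurable
  have "(\<lambda>x. x \<otimes>\<^bsub>SE3\<^esub> g) -` A \<inter> space \<mu> = (\<lambda>x. x \<otimes>\<^bsub>SE3\<^esub> inv\<^bsub>SE3\<^esub> g) ` A"
    unfolding space_haar by (rule SE3.vimage_mult_right[OF g sub])
  then show "emeasure (distr \<mu> \<mu> (\<lambda>x. x \<otimes>\<^bsub>SE3\<^esub> g)) A = emeasure \<mu> A"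
    using haar g A by (simp add: emeasure_distr haar_SE3_def)
qed simp

text \<open>Left and right invariance are used in turn: the left factor is absorbed into \<mu>
  first, then the right one.\<close>

lemma nn_integral_haar_mult:
  assumes f [measurable]: "f \<in> borel_measurable \<mu>"
    and a: "a \<in> carrier SE3" and b: "b \<in> carrier SE3"
  shows "(\<integral>\<^sup>+x. f (a \<otimes>\<^bsub>SE3\<^esub> x \<otimes>\<^bsub>SE3\<^esub> b) \<partial>\<mu>) = (\<integral>\<^sup>+x. f x \<partial>\<mu>)"
proof -
  have ab: "a \<in> space SE3_borel" "b \<in> space SE3_borel" using a b by simp_all
  have [measurable]: "(\<lambda>x. a \<otimes>\<^bsub>SE3\<^esub> x) \<in> \<mu> \<rightarrow>\<^sub>M \<mu>" "(\<lambda>x. x \<otimes>\<^bsub>SE3\<^esub> b) \<in> \<mu> \<rightarrow>\<^sub>M \<mu>"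
    using ab by measurable
  have "(\<integral>\<^sup>+x. f (a \<otimes>\<^bsub>SE3\<^esub> x \<otimes>\<^bsub>SE3\<^esub> b) \<partial>\<mu>) = (\<integral>\<^sup>+x. f (x \<otimes>\<^bsub>SE3\<^esub> b) \<partial>distr \<mu> \<mu> (\<lambda>x. a \<otimes>\<^bsub>SE3\<^esub> x))"
    by (simp add: nn_integral_distr)
  also have "\<dots> = (\<integral>\<^sup>+x. f x \<partial>distr \<mu> \<mu> (\<lambda>x. x \<otimes>\<^bsub>SE3\<^esub> b))"
    unfolding distr_haar_mult_left[OF a] by (simp add: nn_integral_distr)
  finally show ?thesis
    unfolding distr_haar_mult_right[OF b] .
qed

section \<open>Averages of a function over conjugated arguments\<close>

lemma measurable_conjugate:
  assumes [measurable]: "f \<in> borel_measurable \<mu>" and sets_Q [measurable_cong]: "sets Q = sets SE3_borel"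
    and a: "a \<in> carrier SE3"
  shows "(\<lambda>(g, h). f (inv\<^bsub>SE3\<^esub> h \<otimes>\<^bsub>SE3\<^esub> a \<otimes>\<^bsub>SE3\<^esub> g \<otimes>\<^bsub>SE3\<^esub> h)) \<in> borel_measurable (\<mu> \<Otimes>\<^sub>M Q)"
proof -
  have [measurable]: "f \<in> borel_measurable SE3_borel"
    using assms(1) by measurable
  have a': "a \<in> space SE3_borel" using a by simp
  show ?thesis
    using a' by measurable
qed

text \<open>Fixing \<open>g\<close> in the jointly measurable map. Tonelli uses the joint version;
  integrals over \<open>h\<close> at a single \<open>g\<close> use this one.\<close>

lemma measurable_conjugate_section:
  assumes [measurable]: "f \<in> borel_measurable \<mu>" and sets_Q [measurable_cong]: "sets Q = sets SE3_borel"
    and a: "a \<in> carrier SE3" and g: "g \<in> carrier SE3"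
  shows "(\<lambda>h. f (inv\<^bsub>SE3\<^esub> h \<otimes>\<^bsub>SE3\<^esub> a \<otimes>\<^bsub>SE3\<^esub> g \<otimes>\<^bsub>SE3\<^esub> h)) \<in> borel_measurable Q"
  using measurable_compose[OF measurable_Pair1' measurable_conjugate[OF assms(1-3)], of g] g
  by (simp add: space_haar)

text \<open>After exchanging the integrals, the inner one runs over \<open>g\<close> with
  \<open>h\<close> fixed. There the argument of \<open>f\<close> is \<open>g\<close> multiplied by
  fixed group elements on both sides, so bi-invariance of \<mu> makes the inner integral independent
  of \<open>h\<close>, and \<open>Q\<close> has mass 1.\<close>

lemma nn_integral_average_conjugate:
  assumes f: "f \<in> borel_measurable \<mu>"
    and Q: "prob_space Q" and sets_Q: "sets Q = sets SE3_borel"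
    and a: "a \<in> carrier SE3"
  shows "(\<integral>\<^sup>+g. \<integral>\<^sup>+h. f (inv\<^bsub>SE3\<^esub> h \<otimes>\<^bsub>SE3\<^esub> a \<otimes>\<^bsub>SE3\<^esub> g \<otimes>\<^bsub>SE3\<^esub> h) \<partial>Q \<partial>\<mu>) = (\<integral>\<^sup>+g. f g \<partial>\<mu>)"
proof -
  interpret Q: prob_space Q by (rule Q)
  interpret \<mu>: sigma_finite_measure \<mu> by (rule sigma_finite_haar)
  interpret pair_sigma_finite \<mu> Q ..
  have space_Q: "space Q = carrier SE3"
    using sets_eq_imp_space_eq[OF sets_Q] by simp
  have "(\<integral>\<^sup>+g. \<integral>\<^sup>+h. f (inv\<^bsub>SE3\<^esub> h \<otimes>\<^bsub>SE3\<^esub> a \<otimes>\<^bsub>SE3\<^esub> g \<otimes>\<^bsub>SE3\<^esub> h) \<partial>Q \<partial>\<mu>) =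
      (\<integral>\<^sup>+h. \<integral>\<^sup>+g. f (inv\<^bsub>SE3\<^esub> h \<otimes>\<^bsub>SE3\<^esub> a \<otimes>\<^bsub>SE3\<^esub> g \<otimes>\<^bsub>SE3\<^esub> h) \<partial>\<mu> \<partial>Q)"
    using Fubini'[OF measurable_conjugate[OF f sets_Q a]] by simp
  also have "\<dots> = (\<integral>\<^sup>+h. (\<integral>\<^sup>+g. f g \<partial>\<mu>) \<partial>Q)"
    using a by (intro nn_integral_cong nn_integral_haar_mult f) (auto simp: space_Q)
  finally show ?thesis
    by (simp add: Q.emeasure_space_1)
qed

section \<open>Bi-equivariance for mechanisms given by probability measures\<close>

context
  fixes K :: "rigid \<Rightarrow> real"
  assumes K_density: "probability_density \<mu> (\<lambda>g. ennreal (K g))"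
    and K_square_integrable: "square_integrable \<mu> (\<lambda>g. ennreal (K g))"
begin

lemma K_measurable: "(\<lambda>g. ennreal (K g)) \<in> borel_measurable \<mu>"
  using K_density by (simp add: probability_density_def)

lemma
  assumes P: "frame_selection P"
    and g0: "g0 \<in> carrier SE3" and Os: "Os \<in> point_clouds" and Oe: "Oe \<in> point_clouds"
  shows probability_density_frame_kernel: "probability_density \<mu> (\<lambda>g. frame_kernel K P g g0 Os Oe)"
    and square_integrable_frame_kernel: "square_integrable \<mu> (\<lambda>g. frame_kernel K P g g0 Os Oe)"
proof -
  define Q where "Q = P (inv\<^bsub>SE3\<^esub> g0 \<bullet>\<^sub>c Os) Oe"
  have Q: "prob_space Q" and sets_Q: "sets Q = sets SE3_borel"
    using P Oe cloud_act_closed[OF Os] by (auto simp: Q_def frame_selection_def)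
  interpret Q: prob_space Q by (rule Q)
  have a: "inv\<^bsub>SE3\<^esub> g0 \<in> carrier SE3" using g0 by simp
  let ?k = "\<lambda>g h. ennreal (K (inv\<^bsub>SE3\<^esub> h \<otimes>\<^bsub>SE3\<^esub> inv\<^bsub>SE3\<^esub> g0 \<otimes>\<^bsub>SE3\<^esub> g \<otimes>\<^bsub>SE3\<^esub> h))"
  have kernel: "frame_kernel K P g g0 Os Oe = (\<integral>\<^sup>+h. ?k g h \<partial>Q)" for g
    by (simp add: frame_kernel_def Q_def)
  have meas: "(\<lambda>g. frame_kernel K P g g0 Os Oe) \<in> borel_measurable \<mu>"
    unfolding kernel
    by (rule Q.borel_measurable_nn_integral[OF measurable_conjugate[OF K_measurable sets_Q a]])
  then show "probability_density \<mu> (\<lambda>g. frame_kernel K P g g0 Os Oe)"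
    using nn_integral_average_conjugate[OF K_measurable Q sets_Q a] K_density
    by (simp add: probability_density_def kernel)
  \<comment> \<open>The averaging identity is applied a second time, now to the square of
    \<open>K\<close>.\<close>
  have K2: "(\<lambda>g. (ennreal (K g))\<^sup>2) \<in> borel_measurable \<mu>"
    using K_measurable by measurable
  \<comment> \<open>For each \<open>g\<close> the kernel value is a mean under \<open>Q\<close>, so
    its square is at most the mean of the squares.\<close>
  have "(\<integral>\<^sup>+g. (frame_kernel K P g g0 Os Oe)\<^sup>2 \<partial>\<mu>) \<le> (\<integral>\<^sup>+g. \<integral>\<^sup>+h. (?k g h)\<^sup>2 \<partial>Q \<partial>\<mu>)"
    unfolding kernel
    by (intro nn_integral_mono Q.nn_integral_power2_le
        measurable_conjugate_section[OF K_measurable sets_Q a]) (simp add: space_haar)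
  also have "\<dots> = (\<integral>\<^sup>+g. (ennreal (K g))\<^sup>2 \<partial>\<mu>)"
    by (rule nn_integral_average_conjugate[OF K2 Q sets_Q a])
  also have "\<dots> < \<infinity>"
    using K_square_integrable by (simp add: square_integrable_def)
  finally show "square_integrable \<mu> (\<lambda>g. frame_kernel K P g g0 Os Oe)"
    using meas by (simp add: square_integrable_def)
qed

lemma frame_kernel_left_equivariant:
  assumes P: "frame_selection P"
    and d: "d \<in> carrier SE3" and g: "g \<in> carrier SE3" and g0: "g0 \<in> carrier SE3"
    and Os: "Os \<in> point_clouds" and Oe: "Oe \<in> point_clouds"
  shows "frame_kernel K P (d \<otimes>\<^bsub>SE3\<^esub> g) (d \<otimes>\<^bsub>SE3\<^esub> g0) (d \<bullet>\<^sub>c Os) Oe = frame_kernel K P g g0 Os Oe"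
proof -
  \<comment> \<open>This cancellation leaves the conditioning cloud, and so the measure integrated
    against, unchanged; the same cancellation inside \<open>K\<close> then gives equal
    integrands.\<close>
  have "inv\<^bsub>SE3\<^esub> (d \<otimes>\<^bsub>SE3\<^esub> g0) \<otimes>\<^bsub>SE3\<^esub> d = inv\<^bsub>SE3\<^esub> g0"
    using d g0 by (simp add: SE3.inv_mult_group SE3.m_assoc)
  then have cloud: "inv\<^bsub>SE3\<^esub> (d \<otimes>\<^bsub>SE3\<^esub> g0) \<bullet>\<^sub>c d \<bullet>\<^sub>c Os = inv\<^bsub>SE3\<^esub> g0 \<bullet>\<^sub>c Os"
    by (simp flip: cloud_act_mult)
  have "space (P (inv\<^bsub>SE3\<^esub> g0 \<bullet>\<^sub>c Os) Oe) = carrier SE3"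
    using P Oe cloud_act_closed[OF Os] sets_eq_imp_space_eq space_SE3_borel
    unfolding frame_selection_def by metis
  moreover have "inv\<^bsub>SE3\<^esub> h \<otimes>\<^bsub>SE3\<^esub> inv\<^bsub>SE3\<^esub> (d \<otimes>\<^bsub>SE3\<^esub> g0) \<otimes>\<^bsub>SE3\<^esub> (d \<otimes>\<^bsub>SE3\<^esub> g) \<otimes>\<^bsub>SE3\<^esub> h =
      inv\<^bsub>SE3\<^esub> h \<otimes>\<^bsub>SE3\<^esub> inv\<^bsub>SE3\<^esub> g0 \<otimes>\<^bsub>SE3\<^esub> g \<otimes>\<^bsub>SE3\<^esub> h" if "h \<in> carrier SE3" for h
    using d g g0 that by (simp add: SE3.inv_mult_group SE3.m_assoc SE3.inv_solve_left')
  ultimately show ?thesis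
    unfolding frame_kernel_def cloud by (intro nn_integral_cong) simp
qed

lemma frame_kernel_right_equivariant:
  assumes P: "frame_selection P" and eq: "equivariant_frame_selection P"
    and d: "d \<in> carrier SE3" and g: "g \<in> carrier SE3" and g0: "g0 \<in> carrier SE3"
    and Os: "Os \<in> point_clouds" and Oe: "Oe \<in> point_clouds"
  shows "frame_kernel K P (g \<otimes>\<^bsub>SE3\<^esub> inv\<^bsub>SE3\<^esub> d) (g0 \<otimes>\<^bsub>SE3\<^esub> inv\<^bsub>SE3\<^esub> d) Os (d \<bullet>\<^sub>c Oe) =
    frame_kernel K P g g0 Os Oe"
proof -
  define Q where "Q = P (inv\<^bsub>SE3\<^esub> g0 \<bullet>\<^sub>c Os) Oe"
  have sets_Q [measurable_cong]: "sets Q = sets SE3_borel"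
    using P Oe cloud_act_closed[OF Os] by (auto simp: Q_def frame_selection_def)
  have space_Q: "space Q = carrier SE3"
    using sets_eq_imp_space_eq[OF sets_Q] by simp
  \<comment> \<open>Inverting \<open>g0\<close> times \<open>inv d\<close> puts \<open>d\<close> in
    front, which is exactly how the moved first cloud appears in the equivariance
    hypothesis.\<close>
  have inv: "inv\<^bsub>SE3\<^esub> (g0 \<otimes>\<^bsub>SE3\<^esub> inv\<^bsub>SE3\<^esub> d) = d \<otimes>\<^bsub>SE3\<^esub> inv\<^bsub>SE3\<^esub> g0"
    using d g0 by (simp add: SE3.inv_mult_group)
  have moved: "P ((d \<otimes>\<^bsub>SE3\<^esub> inv\<^bsub>SE3\<^esub> g0) \<bullet>\<^sub>c Os) (d \<bullet>\<^sub>c Oe) = distr Q SE3_borel (\<lambda>h. d \<otimes>\<^bsub>SE3\<^esub> h)"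
    using eq d g0 Os Oe by (simp add: equivariant_frame_selection_def Q_def)
  let ?k = "\<lambda>h. ennreal (K (inv\<^bsub>SE3\<^esub> h \<otimes>\<^bsub>SE3\<^esub> (d \<otimes>\<^bsub>SE3\<^esub> inv\<^bsub>SE3\<^esub> g0) \<otimes>\<^bsub>SE3\<^esub> (g \<otimes>\<^bsub>SE3\<^esub> inv\<^bsub>SE3\<^esub> d) \<otimes>\<^bsub>SE3\<^esub> h))"
  have k: "?k \<in> borel_measurable SE3_borel"
    using d g g0 by (intro measurable_conjugate_section[OF K_measurable]) simp_all
  have d': "d \<in> space SE3_borel" using d by simp
  have mult: "(\<lambda>h. d \<otimes>\<^bsub>SE3\<^esub> h) \<in> Q \<rightarrow>\<^sub>M SE3_borel"
    using d' by measurable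
  \<comment> \<open>Once \<open>h\<close> is replaced by \<open>d\<close> times \<open>h\<close>,
    each \<open>d\<close> meets an adjacent inverse: one pair before \<open>inv g0\<close>, one pair
    after \<open>g\<close>.\<close>
  have "inv\<^bsub>SE3\<^esub> (d \<otimes>\<^bsub>SE3\<^esub> h) \<otimes>\<^bsub>SE3\<^esub> (d \<otimes>\<^bsub>SE3\<^esub> inv\<^bsub>SE3\<^esub> g0) \<otimes>\<^bsub>SE3\<^esub> (g \<otimes>\<^bsub>SE3\<^esub> inv\<^bsub>SE3\<^esub> d) \<otimes>\<^bsub>SE3\<^esub> (d \<otimes>\<^bsub>SE3\<^esub> h) =
      inv\<^bsub>SE3\<^esub> h \<otimes>\<^bsub>SE3\<^esub> inv\<^bsub>SE3\<^esub> g0 \<otimes>\<^bsub>SE3\<^esub> g \<otimes>\<^bsub>SE3\<^esub> h" if "h \<in> carrier SE3" for h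
    using d g g0 that by (simp add: SE3.inv_mult_group SE3.m_assoc SE3.inv_solve_left')
  then have "(\<integral>\<^sup>+h. ?k (d \<otimes>\<^bsub>SE3\<^esub> h) \<partial>Q) = frame_kernel K P g g0 Os Oe"
    unfolding frame_kernel_def Q_def[symmetric] by (intro nn_integral_cong) (simp add: space_Q)
  then show ?thesis
    unfolding frame_kernel_def[of K P "g \<otimes>\<^bsub>SE3\<^esub> inv\<^bsub>SE3\<^esub> d"] inv moved
    using mult k by (simp add: nn_integral_distr)
qed

lemma bi_equivariant_frame_kernel:
  assumes P: "frame_selection P" and eq: "equivariant_frame_selection P"
  shows "bi_equivariant_diffusion_kernel \<mu> (frame_kernel K P)"
  unfolding bi_equivariant_diffusion_kernel_def
  using probability_density_frame_kernel[OF P] square_integrable_frame_kernel[OF P]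
    frame_kernel_left_equivariant[OF P] frame_kernel_right_equivariant[OF P eq]
  by (auto intro!: AE_I2 simp: space_haar)

end

section \<open>Mechanisms given by densities, reduced to measures\<close>

lemma
  assumes p: "frame_selection_density \<mu> p"
  defines "P \<equiv> \<lambda>O1 O2. density \<mu> (\<lambda>h. ennreal (p h O1 O2))"
  shows frame_selection_density_measure: "frame_selection P"
    and equivariant_density_measure:
      "equivariant_frame_selection_density p \<Longrightarrow> equivariant_frame_selection P"
proof -
  have meas: "(\<lambda>h. ennreal (p h O1 O2)) \<in> borel_measurable \<mu>"
    if "O1 \<in> point_clouds" "O2 \<in> point_clouds" for O1 O2
    using p that by (simp add: frame_selection_density_def probability_density_def)
  show "frame_selection P"
    unfolding frame_selection_def
  proof (intro ballI conjI)
    fix O1 O2 :: "(real^3) set" assume O: "O1 \<in> point_clouds" "O2 \<in> point_clouds"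
    have "emeasure (P O1 O2) (space (P O1 O2)) = (\<integral>\<^sup>+h. ennreal (p h O1 O2) \<partial>\<mu>)"
      using meas[OF O] by (auto simp: P_def emeasure_density intro!: nn_integral_cong)
    also have "\<dots> = 1"
      using p O by (simp add: frame_selection_density_def probability_density_def)
    finally show "prob_space (P O1 O2)" by (rule prob_spaceI)
    show "sets (P O1 O2) = sets SE3_borel" by (simp add: P_def sets_haar)
  qed
  assume eq: "equivariant_frame_selection_density p"
  show "equivariant_frame_selection P"
    unfolding equivariant_frame_selection_def
  proof (intro ballI)
    fix d g0 :: rigid and Os Oe :: "(real^3) set"
    assume d: "d \<in> carrier SE3" and g0: "g0 \<in> carrier SE3"
      and Os: "Os \<in> point_clouds" and Oe: "Oe \<in> point_clouds"
    define f where "f h = ennreal (p h (inv\<^bsub>SE3\<^esub> g0 \<bullet>\<^sub>c Os) Oe)" for h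
    define f' where "f' h = ennreal (p h ((d \<otimes>\<^bsub>SE3\<^esub> inv\<^bsub>SE3\<^esub> g0) \<bullet>\<^sub>c Os) (d \<bullet>\<^sub>c Oe))" for h
    have [measurable]: "f \<in> borel_measurable \<mu>" "f' \<in> borel_measurable \<mu>"
      unfolding f_def f'_def by (intro meas cloud_act_closed Os Oe)+
    have ff': "f h = f' (d \<otimes>\<^bsub>SE3\<^esub> h)" if "h \<in> carrier SE3" for h
      using eq d g0 Os Oe that unfolding equivariant_frame_selection_density_def f_def f'_def by metis
    have d': "d \<in> space SE3_borel" using d by simp
    have mult [measurable]: "(\<lambda>h. d \<otimes>\<^bsub>SE3\<^esub> h) \<in> \<mu> \<rightarrow>\<^sub>M \<mu>"
      using d' by measurable
    \<comment> \<open>The identity \<open>ff'\<close> is known only on the carrier, which is the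
      whole space of \<mu>, so it suffices for equality of the density measures.\<close>
    have "density \<mu> f = density \<mu> (\<lambda>h. f' (d \<otimes>\<^bsub>SE3\<^esub> h))"
      by (rule density_cong) (auto intro!: AE_I2 simp: ff' space_haar)
    \<comment> \<open>Pushing forward a density that factors through the translation gives the
      density \<open>f'\<close> over the pushed-forward \<mu>, and left invariance identifies the
      latter with \<mu>.\<close>
    then have "distr (density \<mu> f) \<mu> (\<lambda>h. d \<otimes>\<^bsub>SE3\<^esub> h) = density (distr \<mu> \<mu> (\<lambda>h. d \<otimes>\<^bsub>SE3\<^esub> h)) f'"
      by (simp add: density_distr)
    also have "\<dots> = density \<mu> f'"
      by (simp only: distr_haar_mult_left[OF d])
    \<comment> \<open>The target changes from \<mu> to \<open>SE3_borel\<close>; a pushforward sees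
      only the measurable sets of its target, and these agree.\<close>
    finally have "distr (density \<mu> f) SE3_borel (\<lambda>h. d \<otimes>\<^bsub>SE3\<^esub> h) = density \<mu> f'"
      using distr_cong[OF refl sets_haar refl] by metis
    then show "distr (P (inv\<^bsub>SE3\<^esub> g0 \<bullet>\<^sub>c Os) Oe) SE3_borel (\<lambda>h. d \<otimes>\<^bsub>SE3\<^esub> h) =
        P ((d \<otimes>\<^bsub>SE3\<^esub> inv\<^bsub>SE3\<^esub> g0) \<bullet>\<^sub>c Os) (d \<bullet>\<^sub>c Oe)"
      by (simp add: P_def f_def[abs_def] f'_def[abs_def])
  qed
qed

lemma frame_kernel_density_eq:
  assumes p: "frame_selection_density \<mu> p" and K: "(\<lambda>g. ennreal (K g)) \<in> borel_measurable \<mu>"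
    and g: "g \<in> carrier SE3" and g0: "g0 \<in> carrier SE3"
    and Os: "Os \<in> point_clouds" and Oe: "Oe \<in> point_clouds"
  shows "frame_kernel_density \<mu> K p g g0 Os Oe =
    frame_kernel K (\<lambda>O1 O2. density \<mu> (\<lambda>h. ennreal (p h O1 O2))) g g0 Os Oe"
proof -
  have "(\<lambda>h. ennreal (p h (inv\<^bsub>SE3\<^esub> g0 \<bullet>\<^sub>c Os) Oe)) \<in> borel_measurable \<mu>"
    using p Oe cloud_act_closed[OF Os]
    by (simp add: frame_selection_density_def probability_density_def)
  then show ?thesis
    unfolding frame_kernel_def frame_kernel_density_def using g g0
    by (simp add: nn_integral_density measurable_conjugate_section[OF K sets_haar])
qed

end

text \<open>Transfers bi-equivariance between the two forms of the kernel, whose equality is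
  established only for rigid motions and point clouds. The moved arguments stay in these sets
  because the group and \<open>point_clouds\<close> are closed under the operations
  involved.\<close>

lemma bi_equivariant_diffusion_kernel_cong:
  assumes \<mu>: "space \<mu> = carrier SE3"
    and eq: "\<And>g g0 Os Oe. g \<in> carrier SE3 \<Longrightarrow> g0 \<in> carrier SE3 \<Longrightarrow> Os \<in> point_clouds \<Longrightarrow>
      Oe \<in> point_clouds \<Longrightarrow> P g g0 Os Oe = P' g g0 Os Oe"
  shows "bi_equivariant_diffusion_kernel \<mu> P \<longleftrightarrow> bi_equivariant_diffusion_kernel \<mu> P'"
proof -
  have "probability_density \<mu> (\<lambda>g. P g g0 Os Oe) \<longleftrightarrow> probability_density \<mu> (\<lambda>g. P' g g0 Os Oe)"
    "square_integrable \<mu> (\<lambda>g. P g g0 Os Oe) \<longleftrightarrow> square_integrable \<mu> (\<lambda>g. P' g g0 Os Oe)"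
    if "g0 \<in> carrier SE3" "Os \<in> point_clouds" "Oe \<in> point_clouds" for g0 Os Oe
    using that measurable_cong[of \<mu> "\<lambda>g. P g g0 Os Oe" "\<lambda>g. P' g g0 Os Oe" borel]
    unfolding probability_density_def square_integrable_def
    by (simp_all add: \<mu> eq cong: nn_integral_cong_simp)
  then show ?thesis
    unfolding bi_equivariant_diffusion_kernel_def
    by (intro ball_cong conj_cong AE_cong) (simp_all add: \<mu> eq cloud_act_closed)
qed

theorem proposition3:
  fixes \<mu> :: "rigid measure" and K :: "rigid \<Rightarrow> real"
  assumes haar: "haar_SE3 \<mu>"
    and K_nonneg: "\<And>g. g \<in> carrier SE3 \<Longrightarrow> 0 \<le> K g"
    and K_density: "probability_density \<mu> (\<lambda>g. ennreal (K g))"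
    and K_square_integrable: "square_integrable \<mu> (\<lambda>g. ennreal (K g))"
  shows "(\<forall>p. frame_selection_density \<mu> p \<and> equivariant_frame_selection_density p \<longrightarrow>
              bi_equivariant_diffusion_kernel \<mu> (frame_kernel_density \<mu> K p)) \<and>
         (\<forall>P. frame_selection P \<and> equivariant_frame_selection P \<longrightarrow>
              bi_equivariant_diffusion_kernel \<mu> (frame_kernel K P))"
proof (intro conjI allI impI; elim conjE)
  note bi_equivariant = bi_equivariant_frame_kernel[OF haar K_density K_square_integrable]
  fix p assume p: "frame_selection_density \<mu> p" and eq: "equivariant_frame_selection_density p"
  note K = K_measurable[OF haar K_density K_square_integrable]
  show "bi_equivariant_diffusion_kernel \<mu> (frame_kernel_density \<mu> K p)"
    using bi_equivariant[OF frame_selection_density_measure[OF haar p]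
        equivariant_density_measure[OF haar p eq]]
    by (subst bi_equivariant_diffusion_kernel_cong
        [OF space_haar[OF haar] frame_kernel_density_eq[OF haar p K]])
next
  fix P assume "frame_selection P" and "equivariant_frame_selection P"
  then show "bi_equivariant_diffusion_kernel \<mu> (frame_kernel K P)"
    by (rule bi_equivariant_frame_kernel[OF haar K_density K_square_integrable])
qed

end
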